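(* Let $k\ge1$ and $\ell$ be integers, let $G=(V,E)$ be a $(k,\ell)$-sparse hypergraph of dimension $s$ with $0\le\ell\le sk-1$, and let $C_1\neq C_2$ be components of $G$. Then $E(C_1)$ and $E(C_2)$ are disjoint and $|V(C_1)\cap V(C_2)|<s$. If moreover $\ell\le k$, then $C_1$ and $C_2$ are vertex disjoint. If $\ell=0$, then $G$ has only one component.
   Context: A hypergraph $G=(V,E)$ consists of a finite vertex set $V$ and a finite multiset $E$ of nonempty subsets of $V$ (edges; parallel copies allowed, an edge of size one is a loop). The dimension of an edge $e$ is $|e|$, and the dimension of $G$ is the minimum dimension of its edges. For $V'\subseteq V$, $E(V')$ denotes the multiset of edges of $G$ contained in $V'$. For integers $k\ge1$ and $\ell$, a hypergraph is $(k,\ell)$-sparse if $|E(V')|\le k|V'|-\ell$ for every $V'\subseteq V$ with $E(V')$ nonempty, and $(k,\ell)$-tight if it is $(k,\ell)$-sparse and has exactly $k|V|-\ell$ edges. A block of a $(k,\ell)$-sparse hypergraph $G$ is a subgraph $B=(V(B),E(B))$ of $G$ ($V(B)\subseteq V$, $E(B)\subseteq E$, each edge of $E(B)$ contained in $V(B)$) that is $(k,\ell)$-tight. A component of $G$ is a block that is maximal under inclusion among blocks of $G$. *)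

theory Defs
  imports Main "HOL-Library.Multiset"
begin

record 'a hypergraph =
  verts :: "'a set"
  edges :: "'a set multiset"

definition wf_hypergraph :: "'a hypergraph \<Rightarrow> bool" where
  "wf_hypergraph G \<longleftrightarrow>
     finite (verts G) \<and> (\<forall>e \<in># edges G. e \<noteq> {} \<and> e \<subseteq> verts G)"

text \<open>If there are no edges this is the unspecified value \<open>Min {}\<close>.\<close>

definition dimension :: "'a hypergraph \<Rightarrow> nat" where
  "dimension G = Min (card ` set_mset (edges G))"

definition induced_edges :: "'a hypergraph \<Rightarrow> 'a set \<Rightarrow> 'a set multiset" where
  "induced_edges G V' = {# e \<in># edges G. e \<subseteq> V' #}"

definition sparse :: "int \<Rightarrow> int \<Rightarrow> 'a hypergraph \<Rightarrow> bool" where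
  "sparse k l G \<longleftrightarrow>
     (\<forall>V' \<subseteq> verts G. induced_edges G V' \<noteq> {#} \<longrightarrow>
        int (size (induced_edges G V')) \<le> k * int (card V') - l)"

definition tight :: "int \<Rightarrow> int \<Rightarrow> 'a hypergraph \<Rightarrow> bool" where
  "tight k l G \<longleftrightarrow>
     sparse k l G \<and> int (size (edges G)) = k * int (card (verts G)) - l"

definition subgraph :: "'a hypergraph \<Rightarrow> 'a hypergraph \<Rightarrow> bool" where
  "subgraph B G \<longleftrightarrow>
     verts B \<subseteq> verts G \<and> edges B \<subseteq># edges G \<and> (\<forall>e \<in># edges B. e \<subseteq> verts B)"

definition block :: "int \<Rightarrow> int \<Rightarrow> 'a hypergraph \<Rightarrow> 'a hypergraph \<Rightarrow> bool" where
  "block k l G B \<longleftrightarrow> subgraph B G \<and> tight k l B"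

definition is_component :: "int \<Rightarrow> int \<Rightarrow> 'a hypergraph \<Rightarrow> 'a hypergraph \<Rightarrow> bool" where
  "is_component k l G C \<longleftrightarrow>
     block k l G C \<and> (\<forall>B. block k l G B \<and> subgraph C B \<longrightarrow> B = C)"

end

(* Sparsity of G forces a block B to carry all edges of G inside V(B), so blocks are determined by
   their vertex sets.  Since induced edge counts are supermodular, two blocks whose vertex sets
   meet in W have a block on their union as soon as |E(W)| <= k|W| - l; maximality then
   identifies two components.  This inequality holds if W spans an edge (by sparsity), if |W| >= s
   (as l < sk), if l <= k and W is nonempty, and always if l = 0. *)

theory Submission
  imports Defs
begin

abbreviation induced_subgraph :: "'a hypergraph \<Rightarrow> 'a set \<Rightarrow> 'a hypergraph" where
  "induced_subgraph G U \<equiv> \<lparr>verts = U, edges = induced_edges G U\<rparr>"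

text \<open>An edge inside both \<open>A\<close> and \<open>B\<close> counts twice on each side. An
  edge inside just one of them counts once on the left and still lies in
  \<open>A \<union> B\<close>.\<close>

lemma induced_edges_supermodular:
  "induced_edges G A + induced_edges G B
     \<subseteq># induced_edges G (A \<union> B) + induced_edges G (A \<inter> B)"
  by (rule mset_subset_eqI) (auto simp: induced_edges_def)

text \<open>Parallel copies of an edge pass or fail the containment test together, so taking minima
  of multiplicities loses nothing. This later reduces edge disjointness of two blocks to their
  common vertices.\<close>

lemma induced_edges_inter:
  "induced_edges G A \<inter># induced_edges G B = induced_edges G (A \<inter> B)"
  by (rule multiset_eqI) (auto simp: induced_edges_def)

lemma induced_edges_mono:
  "A \<subseteq> B \<Longrightarrow> induced_edges G A \<subseteq># induced_edges G B"
  by (rule mset_subset_eqI) (auto simp: induced_edges_def)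

lemma subgraph_edges_le_induced:
  assumes "subgraph B G"
  shows "edges B \<subseteq># induced_edges G (verts B)"
proof -
  have "filter_mset (\<lambda>e. e \<subseteq> verts B) (edges B) = edges B"
    using assms by (simp add: subgraph_def filter_mset_eq_conv)
  moreover have "filter_mset (\<lambda>e. e \<subseteq> verts B) (edges B) \<subseteq># induced_edges G (verts B)"
    using assms unfolding subgraph_def induced_edges_def by (intro multiset_filter_mono) simp
  ultimately show ?thesis
    by simp
qed

lemma subgraph_induced_subgraph:
  "U \<subseteq> verts G \<Longrightarrow> subgraph (induced_subgraph G U) G"
  by (auto simp: subgraph_def induced_edges_def)

lemma sparse_induced_subgraph:
  assumes "sparse k l G" "U \<subseteq> verts G"
  shows "sparse k l (induced_subgraph G U)"
proof -
  have "induced_edges (induced_subgraph G U) W = induced_edges G W" if "W \<subseteq> U" for W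
    using that by (auto simp: induced_edges_def filter_filter_mset intro: filter_mset_cong)
  then show ?thesis
    using assms by (simp add: sparse_def)
qed

text \<open>Tightness gives \<open>edges B\<close> the largest size that sparsity of
  \<open>G\<close> allows for edges inside \<open>verts B\<close>. A submultiset of full size is the
  whole multiset.\<close>

lemma block_edges_eq_induced:
  assumes "sparse k l G" "block k l G B"
  shows "edges B = induced_edges G (verts B)"
proof -
  let ?I = "induced_edges G (verts B)"
  have sub: "edges B \<subseteq># ?I" and V: "verts B \<subseteq> verts G"
    using assms(2) subgraph_edges_le_induced by (auto simp: block_def subgraph_def)
  have "int (size (edges B)) = k * int (card (verts B)) - l"
    using assms(2) by (simp add: block_def tight_def)
  \<comment> \<open>Sparsity bounds only nonempty induced multisets; if \<open>?I\<close> is empty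
    the inequality is trivial.\<close>
  then have "size ?I \<le> size (edges B)"
    using assms(1) V by (cases "?I = {#}") (auto simp: sparse_def)
  then show ?thesis
    using sub mset_subset_size[of "edges B" ?I] by (auto simp: subset_mset.less_le)
qed

lemma block_eqI:
  fixes B B' :: "'a hypergraph"
  assumes "sparse k l G" "block k l G B" "block k l G B'" "verts B = verts B'"
  shows "B = B'"
  using block_edges_eq_induced[OF assms(1,2)] block_edges_eq_induced[OF assms(1,3)] assms(4)
  by (intro hypergraph.equality) simp_all

lemma block_induced_subgraph:
  assumes "sparse k l G" "U \<subseteq> verts G"
    and "int (size (induced_edges G U)) = k * int (card U) - l"
  shows "block k l G (induced_subgraph G U)"
  using assms subgraph_induced_subgraph sparse_induced_subgraph
  by (auto simp: block_def tight_def)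

text \<open>Maximality refers to \<open>subgraph\<close>, which also compares edges. Since a
  component has all edges spanned by its vertices, containment of vertex sets is enough to invoke
  it.\<close>

lemma component_eq_block:
  assumes "sparse k l G" "is_component k l G C"
    and "block k l G (induced_subgraph G U)" "verts C \<subseteq> U"
  shows "induced_subgraph G U = C"
proof -
  have "edges C = induced_edges G (verts C)"
    using assms block_edges_eq_induced by (auto simp: is_component_def)
  then have "subgraph C (induced_subgraph G U)"
    using assms(4) induced_edges_mono by (auto simp: subgraph_def induced_edges_def)
  then show ?thesis
    using assms by (auto simp: is_component_def)
qed

text \<open>Uncrossing: the two tight counts add up, cardinality is modular and edge counts are
  supermodular. Subtracting the bound on the intersection leaves at least
  \<open>k * card U - l\<close> edges inside the union \<open>U\<close>; sparsity then makes this an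
  equality if \<open>U\<close> spans an edge.\<close>

lemma components_eqI:
  fixes C1 C2 :: "'a hypergraph"
  assumes "k > 0" "finite (verts G)" "sparse k l G"
    and C1: "is_component k l G C1" and C2: "is_component k l G C2"
    and inter: "int (size (induced_edges G (verts C1 \<inter> verts C2)))
                  \<le> k * int (card (verts C1 \<inter> verts C2)) - l"
  shows "C1 = C2"
proof -
  let ?V1 = "verts C1" and ?V2 = "verts C2"
  let ?U = "?V1 \<union> ?V2"
  have b: "block k l G C1" "block k l G C2"
    using C1 C2 by (auto simp: is_component_def)
  then have V: "?V1 \<subseteq> verts G" "?V2 \<subseteq> verts G"
    by (auto simp: block_def subgraph_def)
  then have fin: "finite ?V1" "finite ?V2"
    using assms(2) finite_subset by blast+
  have sizes: "int (size (induced_edges G ?V1)) = k * int (card ?V1) - l"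
    "int (size (induced_edges G ?V2)) = k * int (card ?V2) - l"
    using b block_edges_eq_induced[OF assms(3)] by (auto simp: block_def tight_def)
  have "k * int (card ?V1) + k * int (card ?V2)
      = k * int (card ?U) + k * int (card (?V1 \<inter> ?V2))"
    using card_Un_Int[OF fin] by (simp flip: distrib_left of_nat_add)
  moreover have "size (induced_edges G ?V1) + size (induced_edges G ?V2)
      \<le> size (induced_edges G ?U) + size (induced_edges G (?V1 \<inter> ?V2))"
    using size_mset_mono[OF induced_edges_supermodular[of G ?V1 ?V2]] by simp
  ultimately have lower: "k * int (card ?U) - l \<le> int (size (induced_edges G ?U))"
    using sizes inter by linarith
  show ?thesis
  proof (cases "induced_edges G ?U = {#}")
    \<comment> \<open>Sparsity says nothing about a union without edges. Here tightness reads
      \<open>k * card V1 = l = k * card V2\<close>, while \<open>lower\<close> reads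
      \<open>k * card U \<le> l\<close>, so both vertex sets already fill the union.\<close>
    case True
    then have "induced_edges G ?V1 = {#}" "induced_edges G ?V2 = {#}"
      using induced_edges_mono[of ?V1 ?U G] induced_edges_mono[of ?V2 ?U G] by simp_all
    then have "k * int (card ?U) \<le> k * int (card ?V1)" "k * int (card ?U) \<le> k * int (card ?V2)"
      using sizes lower True by simp_all
    then have "card ?U \<le> card ?V1" "card ?U \<le> card ?V2"
      using assms(1) by simp_all
    then have "?V1 = ?U" "?V2 = ?U"
      using fin by (intro card_seteq; simp)+
    then show ?thesis
      using block_eqI[OF assms(3) b] by simp
  next
    case False
    then have "int (size (induced_edges G ?U)) = k * int (card ?U) - l"
      using lower assms(3) V by (intro order_antisym) (auto simp: sparse_def)
    then have U: "block k l G (induced_subgraph G ?U)"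
      using V by (intro block_induced_subgraph[OF assms(3)]) simp_all
    \<comment> \<open>The block on the union contains both components, so by maximality it equals
      each of them.\<close>
    show ?thesis
      using component_eq_block[OF assms(3) C1 U] component_eq_block[OF assms(3) C2 U] by simp
  qed
qed

text \<open>A block with the most vertices is a component: any block containing it has the same
  vertex set, and vertex sets determine blocks.\<close>

lemma ex_component_of_ex_block:
  fixes G B :: "'a hypergraph"
  assumes "finite (verts G)" "sparse k l G" "block k l G B"
  shows "\<exists>C. is_component k l G C"
proof -
  have fin: "finite (verts C)" if "block k l G C" for C :: "'a hypergraph"
    using that assms(1) by (auto simp: block_def subgraph_def intro: finite_subset)
  have "card (verts C) \<le> card (verts G)" if "block k l G C" for C :: "'a hypergraph"
    using that assms(1) by (auto simp: block_def subgraph_def intro: card_mono)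
  \<comment> \<open>\<open>Suc\<close> turns the bound by \<open>card (verts G)\<close> into a
    strict one.\<close>
  then obtain C :: "'a hypergraph" where C: "block k l G C"
    and max: "\<And>C'. block k l G C' \<Longrightarrow> card (verts C') \<le> card (verts C)"
    using ex_has_greatest_nat[of "block k l G" B "\<lambda>C. card (verts C)" "Suc (card (verts G))"] assms(3)
    by (auto simp: less_Suc_eq_le)
  have "C' = C" if "block k l G C'" "subgraph C C'" for C' :: "'a hypergraph"
  proof -
    have "verts C = verts C'"
      using that max fin by (intro card_seteq) (auto simp: subgraph_def)
    then show ?thesis
      using block_eqI[OF assms(2) that(1) C] by simp
  qed
  then show ?thesis
    using C by (auto simp: is_component_def)
qed

theorem mainTheorem2:
  fixes k l :: int and s :: nat and G :: "'a hypergraph"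
  assumes "k \<ge> 1"
    and "wf_hypergraph G"
    and "sparse k l G"
    and "dimension G = s"
    and "0 \<le> l" and "l \<le> int s * k - 1"
  shows "(\<forall>C1 C2. is_component k l G C1 \<and> is_component k l G C2 \<and> C1 \<noteq> C2 \<longrightarrow>
            edges C1 \<inter># edges C2 = {#} \<and>
            card (verts C1 \<inter> verts C2) < s \<and>
            (l \<le> k \<longrightarrow> verts C1 \<inter> verts C2 = {})) \<and>
         (l = 0 \<longrightarrow> (\<exists>!C. is_component k l G C))"
proof -
  have k: "k > 0" and fin: "finite (verts G)"
    using assms by (auto simp: wf_hypergraph_def)
  note eqI = components_eqI[OF k fin assms(3)]
  \<comment> \<open>If \<open>W\<close> spans an edge this is sparsity; otherwise the left side is 0
    and the assumption on \<open>l\<close> makes the right side nonnegative.\<close>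
  have card_imp_le: "int (size (induced_edges G W)) \<le> k * int (card W) - l"
    if "W \<subseteq> verts G" "l \<le> k * int (card W)" for W
    using that assms(3) by (cases "induced_edges G W = {#}") (auto simp: sparse_def)
  have inter_sub: "verts C1 \<inter> verts C2 \<subseteq> verts G"
    if "is_component k l G C1" for C1 C2 :: "'a hypergraph"
    using that by (auto simp: is_component_def block_def subgraph_def)
  \<comment> \<open>Contrapositive of uncrossing. The remaining claims on common vertices and on
    uniqueness compare this \<open>l\<close> with \<open>s * k\<close>, \<open>k\<close> and
    0.\<close>
  have small: "k * int (card (verts C1 \<inter> verts C2)) < l"
    if "is_component k l G C1" "is_component k l G C2" "C1 \<noteq> C2" for C1 C2
    using eqI[OF that(1,2)] card_imp_le[OF inter_sub[OF that(1)]] that(3) by (meson not_le)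
  have "edges C1 \<inter># edges C2 = {#} \<and> card (verts C1 \<inter> verts C2) < s \<and>
      (l \<le> k \<longrightarrow> verts C1 \<inter> verts C2 = {})"
    if C: "is_component k l G C1" "is_component k l G C2" "C1 \<noteq> C2" for C1 C2
  proof (intro conjI impI)
    let ?W = "verts C1 \<inter> verts C2"
    have "edges C1 \<inter># edges C2 = induced_edges G ?W"
      using C block_edges_eq_induced[OF assms(3)]
      by (simp add: is_component_def induced_edges_inter)
    \<comment> \<open>An edge inside \<open>?W\<close> would let sparsity supply the bound that
      forces \<open>C1 = C2\<close>.\<close>
    moreover have "induced_edges G ?W = {#}"
      using eqI[OF C(1,2)] C(3) inter_sub[OF C(1), of C2] assms(3) by (auto simp: sparse_def)
    ultimately show "edges C1 \<inter># edges C2 = {#}"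
      by simp
    have "k * int (card ?W) < k * int s"
      using small[OF C] assms(6) by (simp add: mult.commute)
    then show "card ?W < s"
      using k by simp
    show "?W = {}" if "l \<le> k"
    proof -
      have "k * int (card ?W) < k * 1"
        using small[OF C] that by simp
      then have "card ?W = 0"
        using k by (simp only: mult_less_cancel_left_pos)
      then show ?thesis
        using inter_sub[OF C(1)] fin by (meson card_0_eq finite_subset)
    qed
  qed
  moreover have "\<exists>!C. is_component k l G C" if "l = 0"
  proof -
    \<comment> \<open>Edges are nonempty, so the empty vertex set spans none. For
      \<open>l = 0\<close> its count 0 is tight, which provides a first block.\<close>
    have "induced_edges G {} = {#}"
      using assms(2) by (auto simp: induced_edges_def wf_hypergraph_def filter_mset_eq_conv)
    then have "block k l G (induced_subgraph G {})"
      using block_induced_subgraph[OF assms(3), of "{}"] that by simp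
    then have "\<exists>C. is_component k l G C"
      by (rule ex_component_of_ex_block[OF fin assms(3)])
    moreover have "C1 = C2" if "is_component k l G C1" "is_component k l G C2" for C1 C2
    proof (rule ccontr)
      assume "C1 \<noteq> C2"
      then have "k * int (card (verts C1 \<inter> verts C2)) < 0"
        using small that \<open>l = 0\<close> by blast
      then show False
        using k by (simp add: mult_less_0_iff)
    qed
    ultimately show ?thesis
      by blast
  qed
  ultimately show ?thesis
    by blast
qed

end
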